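(* Let $G$ be a finite poset game with $g$ vertices and suppose $\mathrm{Nim}(G)\neq 0$. Let $\neg G$ be the poset game produced from $G$ (without computing $\mathrm{Nim}(G)$) by the following procedure: 1. Set $i=0$ and let the current game be $G$. 2. While $2^i\le g$: add $2^i$ bottom vertices (one after another) to the current game, then put the result next to a $2^i$-tower; this is the new current game; then increment $i$ by $1$. 3. Let the resulting game be $G'$. 4. Take a copy of $G'$, add $2^i$ bottom vertices to it (one after another), and put the result next to a $2^i$-tower, obtaining $G''$. Then increment $i$ by $1$. 5. Put $G'$ next to $G''$ and next to a $2^i$-tower (with the current value of $i$), obtaining $\neg G$. Then $\mathrm{Nim}(\neg G)=0$.
   Context: A poset game is played on a finite partially ordered set $(V,\le)$, whose elements are called vertices. Two players alternate moves; a move consists of choosing a remaining element $v$ and removing all remaining elements $w$ with $w\ge v$. A player who cannot move (because no elements remain) loses. The nim-value $\mathrm{Nim}(G)$ is defined recursively as the smallest non-negative integer $m$ such that no move from $G$ leads to a game of nim-value $m$ (so the empty game has nim-value $0$); the second player has a winning strategy on $G$ if and only if $\mathrm{Nim}(G)=0$. Adding a bottom vertex to a poset means adjoining one new element that is strictly less than all elements present at that time. An $x$-tower is a chain of $x$ elements. Putting games next to each other means taking the disjoint union of the posets, with elements from different components incomparable (disjoint copies are used when a game occurs more than once). *)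

theory Defs
  imports Main "HOL-Library.While_Combinator"
begin

text \<open>
  A poset is given by its reflexive order relation \<open>r\<close>; the pair \<open>(v, w)\<close> in \<open>r\<close> means
  \<open>v \<le> w\<close>, and the set of vertices is \<open>Field r\<close> (an isolated vertex \<open>v\<close> contributes \<open>(v, v)\<close>).
\<close>

definition poset_game :: "'a rel \<Rightarrow> bool" where
  "poset_game r \<longleftrightarrow> finite (Field r) \<and> Partial_order r"

definition move :: "'a rel \<Rightarrow> 'a \<Rightarrow> 'a rel" where
  "move r v = Restr r (- r `` {v})"

definition mex :: "nat set \<Rightarrow> nat" where
  "mex A = (LEAST m. m \<notin> A)"

lemma card_Field_move:
  assumes "poset_game r" "v \<in> Field r"
  shows "card (Field (move r v)) < card (Field r)"
proof (rule psubset_card_mono)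
  show "finite (Field r)"
    using assms by (simp add: poset_game_def)
  have "(v, v) \<in> r"
    using assms
    by (auto simp: poset_game_def partial_order_on_def preorder_on_def refl_on_def)
  then have "v \<notin> Field (move r v)"
    by (auto simp: move_def Field_def)
  moreover have "Field (move r v) \<subseteq> Field r"
    by (auto simp: move_def Field_def)
  ultimately show "Field (move r v) \<subset> Field r"
    using assms by blast
qed

function nim :: "'a rel \<Rightarrow> nat" where
  "nim r = (if poset_game r then mex ((\<lambda>v. nim (move r v)) ` Field r) else undefined)"
  by auto
termination
  by (relation "measure (\<lambda>r. card (Field r))") (auto simp: card_Field_move)

declare nim.simps [simp del]

text \<open>
  The construction repeatedly adjoins vertices, so we use a vertex type closed under the
  operations: \<open>Orig\<close> embeds the given vertices, \<open>Fresh\<close> supplies new ones, and the tags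
  \<open>InL\<close> and \<open>InR\<close> keep combined games disjoint, in particular two copies of the same game.
\<close>

datatype 'a vertex = Orig 'a | Fresh nat | InL "'a vertex" | InR "'a vertex"

definition embed :: "'a rel \<Rightarrow> 'a vertex rel" where
  "embed r = map_prod Orig Orig ` r"

definition add_bottom :: "'a vertex rel \<Rightarrow> 'a vertex rel" where
  "add_bottom r = {Fresh 0} \<times> insert (Fresh 0) (InL ` Field r) \<union> map_prod InL InL ` r"

definition tower :: "nat \<Rightarrow> 'a vertex rel" where
  "tower x = {(Fresh j, Fresh k) | j k. j \<le> k \<and> k < x}"

definition beside :: "'a vertex rel \<Rightarrow> 'a vertex rel \<Rightarrow> 'a vertex rel" where
  "beside r s = map_prod InL InL ` r \<union> map_prod InR InR ` s"

definition stage :: "nat \<Rightarrow> 'a vertex rel \<Rightarrow> 'a vertex rel" where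
  "stage i r = beside ((add_bottom ^^ (2 ^ i)) r) (tower (2 ^ i))"

definition run_stages :: "'a rel \<Rightarrow> nat \<times> 'a vertex rel" where
  "run_stages G =
     while (\<lambda>(i, r). 2 ^ i \<le> card (Field G)) (\<lambda>(i, r). (Suc i, stage i r)) (0, embed G)"

definition neg_game :: "'a rel \<Rightarrow> 'a vertex rel" where
  "neg_game G =
     (let (i, G') = run_stages G;
          G'' = stage i G'
      in beside (beside G' G'') (tower (2 ^ Suc i)))"

end

theory Submission
  imports Defs
begin

text \<open>
  A bottom vertex raises the nim-value by one and a disjoint union has the exclusive or of the
  nim-values, so stage \<open>i\<close> maps a nim-value \<open>n\<close> to \<open>(n + 2 ^ i) XOR 2 ^ i\<close>. This is \<open>n\<close> if bit \<open>i\<close>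
  of \<open>n\<close> is clear and \<open>n + 2 ^ (i + 1)\<close> if it is set; in both cases the quotient \<open>n div 2 ^ i\<close> is
  replaced by its half, rounded up. Since \<open>0 < nim G \<le> g < 2 ^ i\<close> at the end of the loop, the
  quotient is then \<open>1\<close>, that is, \<open>n = nim G'\<close> lies between \<open>2 ^ i\<close> and \<open>2 ^ (i + 1)\<close>. The extra stage
  hence gives \<open>nim G'' = n + 2 ^ (i + 1) = n XOR 2 ^ (i + 1)\<close>, and the last tower cancels the rest.
\<close>

unbundle bit_operations_syntax

section \<open>Minimal excludants and exclusive or\<close>

lemma mex_eqI:
  assumes "m \<notin> A" "\<And>k. k < m \<Longrightarrow> k \<in> A"
  shows "mex A = m"
  unfolding mex_def using assms by (blast intro: Least_equality leI)

lemma mex_notin: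
  assumes "finite A"
  shows "mex A \<notin> A"
proof -
  have "\<exists>m. m \<notin> A"
    using assms ex_new_if_finite infinite_UNIV_nat by blast
  then show ?thesis
    unfolding mex_def by (metis LeastI)
qed

lemma less_mexD: "k < mex A \<Longrightarrow> k \<in> A"
  unfolding mex_def using not_less_Least by blast

lemma mex_le_card:
  assumes "finite A"
  shows "mex A \<le> card A"
proof -
  have "{..<mex A} \<subseteq> A"
    using less_mexD by blast
  then show ?thesis
    using card_mono[OF assms, of "{..<mex A}"] by simp
qed

text \<open>\<open>k XOR b\<close> and \<open>a\<close> differ exactly in the bits where
  \<open>k\<close> and \<open>a XOR b\<close> differ, and so do \<open>k XOR a\<close> and
  \<open>b\<close>. The highest such bit is set in \<open>a XOR b\<close>, hence in exactly one of
  \<open>a\<close> and \<open>b\<close>, and that one gets smaller. Induction by halving avoids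
  naming this bit.\<close>

lemma less_xor_cases:
  fixes a b k :: nat
  assumes "k < a XOR b"
  shows "k XOR b < a \<or> k XOR a < b"
  using assms
proof (induction "a + b" arbitrary: a b k rule: less_induct)
  case less
  have rec: "x XOR y = of_bool (odd x \<noteq> odd y) + 2 * ((x div 2) XOR (y div 2))" for x y :: nat
    by (rule xor_rec)
  have half: "(x XOR y) div 2 = (x div 2) XOR (y div 2)" for x y :: nat
    using rec[of x y] by simp
  show ?case
  proof (cases "k div 2 < (a div 2) XOR (b div 2)")
    case True
    \<comment> \<open>Halving would not shrink \<open>a = b = 0\<close>, but then no
      \<open>k\<close> lies below \<open>a XOR b\<close>.\<close>
    moreover have "a div 2 + b div 2 < a + b"
      using less.prems by (cases "a = 0"; cases "b = 0") auto
    ultimately have "(k div 2) XOR (b div 2) < a div 2 \<or> (k div 2) XOR (a div 2) < b div 2"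
      using less.hyps by blast
    then have "(k XOR b) div 2 < a div 2 \<or> (k XOR a) div 2 < b div 2"
      by (simp add: half)
    then show ?thesis
      by (meson div_le_mono not_le)
  next
    case False
    have "(a XOR b) div 2 \<le> k div 2"
      using False by (simp add: half)
    \<comment> \<open>The halves must agree, so the lowest bit alone separates \<open>k\<close> from
      \<open>a XOR b\<close>.\<close>
    with less.prems have "k div 2 = (a XOR b) div 2 \<and> even k \<and> odd (a XOR b)"
      by presburger
    then have eq: "k div 2 = (a div 2) XOR (b div 2)" and par: "even k" "odd a \<noteq> odd b"
      by (simp_all add: half even_xor_iff)
    have "(k div 2) XOR (b div 2) = a div 2" "(k div 2) XOR (a div 2) = b div 2"
      unfolding eq by (simp_all add: xor.assoc, simp add: xor.commute[of "b div 2"] flip: xor.assoc)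
    then have "(k XOR b) div 2 = a div 2" "(k XOR a) div 2 = b div 2"
      by (simp_all add: half)
    \<comment> \<open>Whichever of \<open>a\<close> and \<open>b\<close> is odd is replaced by an
      even number with the same half.\<close>
    moreover have "odd (k XOR b) \<longleftrightarrow> odd b" "odd (k XOR a) \<longleftrightarrow> odd a"
      using par(1) by (simp_all add: even_xor_iff)
    moreover have "x < y" if "x div 2 = y div 2" "even x" "odd y" for x y :: nat
      using that by presburger
    ultimately show ?thesis
      using par(2) by blast
  qed
qed

text \<open>Arithmetic core of the Sprague-Grundy theorem: \<open>A\<close> and \<open>B\<close>
  hold the option values of two components, and a move changes only one of them. Cancellation
  excludes the value itself; \<open>less_xor_cases\<close> supplies a move to every smaller
  one.\<close>

lemma mex_xor:
  assumes "finite A" "finite B"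
  shows "mex ((\<lambda>x. x XOR mex B) ` A \<union> (\<lambda>y. mex A XOR y) ` B) = mex A XOR mex B"
proof (rule mex_eqI)
  have cancel: "x XOR z = y XOR z \<longleftrightarrow> x = y" "z XOR x = z XOR y \<longleftrightarrow> x = y" for x y z :: nat
    by (metis xor.assoc xor_self_eq xor.right_neutral, metis xor.assoc xor_self_eq xor.left_neutral)
  show "mex A XOR mex B \<notin> (\<lambda>x. x XOR mex B) ` A \<union> (\<lambda>y. mex A XOR y) ` B"
    using mex_notin[OF assms(1)] mex_notin[OF assms(2)] by (auto simp: cancel)
next
  fix k
  assume "k < mex A XOR mex B"
  then consider "k XOR mex B \<in> A" | "k XOR mex A \<in> B"
    using less_xor_cases less_mexD by blast
  then show "k \<in> (\<lambda>x. x XOR mex B) ` A \<union> (\<lambda>y. mex A XOR y) ` B"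
  proof cases
    case 1
    then show ?thesis
      by (intro UnI1 image_eqI[of _ _ "k XOR mex B"]) (simp_all add: xor.assoc)
  next
    case 2
    then show ?thesis
      by (intro UnI2 image_eqI[of _ _ "k XOR mex A"]) (simp_all add: xor.left_commute)
  qed
qed

section \<open>Poset games and their positions\<close>

lemma poset_gameD:
  assumes "poset_game r"
  shows "finite (Field r)" "v \<in> Field r \<Longrightarrow> (v, v) \<in> r"
    "(u, v) \<in> r \<Longrightarrow> (v, w) \<in> r \<Longrightarrow> (u, w) \<in> r"
    "(u, v) \<in> r \<Longrightarrow> (v, u) \<in> r \<Longrightarrow> u = v"
  using assms unfolding poset_game_def partial_order_on_def preorder_on_def refl_on_def
  by (blast dest: transD antisymD)+

lemma poset_gameI:
  assumes "finite (Field r)" "\<And>v. v \<in> Field r \<Longrightarrow> (v, v) \<in> r"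
    "\<And>u v w. (u, v) \<in> r \<Longrightarrow> (v, w) \<in> r \<Longrightarrow> (u, w) \<in> r"
    "\<And>u v. (u, v) \<in> r \<Longrightarrow> (v, u) \<in> r \<Longrightarrow> u = v"
  shows "poset_game r"
proof -
  have "r \<subseteq> Field r \<times> Field r"
    by (auto simp: Field_def)
  moreover have "trans r" "antisym r"
    using assms(3,4) by (blast intro: transI antisymI)+
  ultimately show ?thesis
    using assms(1,2) by (simp add: poset_game_def partial_order_on_def preorder_on_def refl_on_def)
qed

lemma nim_eq: "poset_game r \<Longrightarrow> nim r = mex ((\<lambda>v. nim (move r v)) ` Field r)"
  by (subst nim.simps) simp

text \<open>Vertices exist only through pairs of the relation; reflexivity keeps
  \<open>(w, w)\<close> for a survivor \<open>w\<close> that loses all its other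
  comparabilities.\<close>

lemma Field_move:
  assumes "poset_game r"
  shows "Field (move r v) = Field r - r `` {v}"
proof
  show "Field (move r v) \<subseteq> Field r - r `` {v}"
    by (auto simp: move_def Field_def)
  show "Field r - r `` {v} \<subseteq> Field (move r v)"
  proof
    fix w
    assume "w \<in> Field r - r `` {v}"
    then have "(w, w) \<in> move r v"
      using poset_gameD(2)[OF assms] by (simp add: move_def)
    then show "w \<in> Field (move r v)"
      by (rule FieldI1)
  qed
qed

lemma poset_game_move:
  assumes "poset_game r"
  shows "poset_game (move r v)"
proof (rule poset_gameI)
  show "finite (Field (move r v))"
    using poset_gameD(1)[OF assms] by (simp add: Field_move[OF assms])
  show "(w, w) \<in> move r v" if "w \<in> Field (move r v)" for w
    using that poset_gameD(2)[OF assms] unfolding Field_move[OF assms] by (simp add: move_def)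
  show "(x, z) \<in> move r v" if "(x, y) \<in> move r v" "(y, z) \<in> move r v" for x y z
    using that poset_gameD(3)[OF assms] unfolding move_def by blast
  show "x = y" if "(x, y) \<in> move r v" "(y, x) \<in> move r v" for x y
    using that poset_gameD(4)[OF assms] unfolding move_def by blast
qed

lemma poset_game_empty: "poset_game {}"
  by (rule poset_gameI) auto

lemma nim_empty: "nim {} = 0"
  unfolding nim_eq[OF poset_game_empty] by (rule mex_eqI) simp_all

text \<open>Every value below the nim-value needs a vertex of its own that reaches it. This turns
  the exit condition of the loop, on the number of vertices, into a bound on
  \<open>nim G\<close>.\<close>

lemma nim_le_card:
  assumes "poset_game r"
  shows "nim r \<le> card (Field r)"
proof -
  have "nim r \<le> card ((\<lambda>v. nim (move r v)) ` Field r)"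
    unfolding nim_eq[OF assms] by (rule mex_le_card) (simp add: poset_gameD(1)[OF assms])
  also have "\<dots> \<le> card (Field r)"
    by (rule card_image_le) (rule poset_gameD(1)[OF assms])
  finally show ?thesis .
qed

lemma Field_map_prod: "Field (map_prod f f ` r) = f ` Field r"
proof -
  have "Domain (map_prod f f ` r) = f ` Domain r" "Range (map_prod f f ` r) = f ` Range r"
    by (simp_all add: Domain_fst Range_snd image_image)
  then show ?thesis
    by (simp add: Field_def image_Un)
qed

lemma mem_map_prod_image_iff: "inj f \<Longrightarrow> (f a, f b) \<in> map_prod f f ` r \<longleftrightarrow> (a, b) \<in> r"
  by (auto simp: inj_eq)

lemma poset_game_map_prod:
  assumes "inj f" "poset_game r"
  shows "poset_game (map_prod f f ` r)"
proof (rule poset_gameI)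
  note mem = mem_map_prod_image_iff[OF assms(1)]
  have range: "\<exists>a b. u = f a \<and> v = f b" if "(u, v) \<in> map_prod f f ` r" for u v
    using that by auto
  show "finite (Field (map_prod f f ` r))"
    using poset_gameD(1)[OF assms(2)] by (simp add: Field_map_prod)
  show "(v, v) \<in> map_prod f f ` r" if "v \<in> Field (map_prod f f ` r)" for v
  proof -
    obtain a where "a \<in> Field r" "v = f a"
      using \<open>v \<in> Field (map_prod f f ` r)\<close> unfolding Field_map_prod by blast
    then show ?thesis
      using poset_gameD(2)[OF assms(2)] by (simp add: mem)
  qed
  show "(u, w) \<in> map_prod f f ` r"
    if uv: "(u, v) \<in> map_prod f f ` r" and vw: "(v, w) \<in> map_prod f f ` r" for u v w
  proof -
    obtain a b c where eq: "u = f a" "v = f b" "w = f c"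
      using range[OF uv] range[OF vw] by blast
    show ?thesis
      using poset_gameD(3)[OF assms(2)] uv vw unfolding eq mem by blast
  qed
  show "u = v" if uv: "(u, v) \<in> map_prod f f ` r" and vu: "(v, u) \<in> map_prod f f ` r" for u v
  proof -
    obtain a b where eq: "u = f a" "v = f b"
      using range[OF uv] by blast
    show ?thesis
      using poset_gameD(4)[OF assms(2)] uv vu unfolding eq mem by blast
  qed
qed

lemma move_map_prod: "inj f \<Longrightarrow> move (map_prod f f ` r) (f v) = map_prod f f ` move r v"
  by (auto simp: move_def inj_eq intro!: map_prod_imageI)

lemma nim_map_prod:
  assumes "inj f" "poset_game r"
  shows "nim (map_prod f f ` r) = nim r"
  using assms(2)
proof (induction r rule: nim.induct)
  case (1 r)
  have "nim (move (map_prod f f ` r) (f v)) = nim (move r v)" if "v \<in> Field r" for v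
    using 1(1)[OF 1(2) that poset_game_move[OF 1(2)]] by (simp add: move_map_prod[OF assms(1)])
  then show ?case
    unfolding nim_eq[OF 1(2)] nim_eq[OF poset_game_map_prod[OF assms(1) 1(2)]] Field_map_prod
      image_image by (simp)
qed

lemma poset_game_embed: "poset_game r \<Longrightarrow> poset_game (embed r)"
  unfolding embed_def by (rule poset_game_map_prod) (auto intro: injI)

lemma nim_embed: "poset_game r \<Longrightarrow> nim (embed r) = nim r"
  unfolding embed_def by (rule nim_map_prod) (auto intro: injI)

section \<open>Bottom vertices, towers and disjoint unions\<close>

lemma Field_add_bottom: "Field (add_bottom r) = insert (Fresh 0) (InL ` Field r)"
  unfolding add_bottom_def Field_Un Field_map_prod by (auto simp: Field_def)

lemma poset_game_add_bottom:
  assumes "poset_game r"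
  shows "poset_game (add_bottom r)"
proof (rule poset_gameI)
  show "finite (Field (add_bottom r))"
    using poset_gameD(1)[OF assms] by (simp add: Field_add_bottom)
  show "(v, v) \<in> add_bottom r" if "v \<in> Field (add_bottom r)" for v
    using that poset_gameD(2)[OF assms] unfolding Field_add_bottom
    by (auto simp: add_bottom_def)
  show "(u, w) \<in> add_bottom r" if "(u, v) \<in> add_bottom r" "(v, w) \<in> add_bottom r" for u v w
    using that poset_gameD(3)[OF assms]
    by (auto simp: add_bottom_def intro: FieldI2)
  show "u = v" if "(u, v) \<in> add_bottom r" "(v, u) \<in> add_bottom r" for u v
    using that poset_gameD(4)[OF assms] by (auto simp: add_bottom_def)
qed

lemma move_add_bottom_Fresh: "move (add_bottom r) (Fresh 0) = {}"
  by (auto simp: move_def add_bottom_def intro: FieldI1)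

lemma move_add_bottom_InL:
  assumes "poset_game r"
  shows "move (add_bottom r) (InL v) = add_bottom (move r v)"
  unfolding add_bottom_def Field_move[OF assms]
  by (auto simp: move_def intro!: map_prod_imageI)

text \<open>Taking the new bottom empties the board; any other move leaves it in place. So the
  option values are \<open>0\<close> and, by induction, the successors of the old ones.\<close>

lemma nim_add_bottom: "poset_game r \<Longrightarrow> nim (add_bottom r) = Suc (nim r)"
proof (induction r rule: nim.induct)
  case (1 r)
  let ?A = "(\<lambda>v. nim (move r v)) ` Field r"
  have "finite ?A"
    using poset_gameD(1)[OF 1(2)] by simp
  have "nim (move (add_bottom r) (InL v)) = Suc (nim (move r v))" if "v \<in> Field r" for v
    using 1(1)[OF 1(2) that poset_game_move[OF 1(2)]] by (simp add: move_add_bottom_InL[OF 1(2)])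
  then have "(\<lambda>v. nim (move (add_bottom r) v)) ` Field (add_bottom r) = insert 0 (Suc ` ?A)"
    unfolding Field_add_bottom image_insert image_image
    by (simp add: move_add_bottom_Fresh nim_empty)
  moreover have "mex (insert 0 (Suc ` ?A)) = Suc (mex ?A)"
  proof (rule mex_eqI)
    show "Suc (mex ?A) \<notin> insert 0 (Suc ` ?A)"
      using mex_notin[OF \<open>finite ?A\<close>] by auto
    show "k \<in> insert 0 (Suc ` ?A)" if "k < Suc (mex ?A)" for k
      using that less_mexD[of _ ?A] by (cases k) blast+
  qed
  ultimately show ?case
    unfolding nim_eq[OF 1(2)] nim_eq[OF poset_game_add_bottom[OF 1(2)]] by simp
qed

lemma add_bottom_funpow:
  assumes "poset_game r"
  shows "poset_game ((add_bottom ^^ k) r) \<and> nim ((add_bottom ^^ k) r) = nim r + k"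
  using assms by (induction k) (simp_all add: poset_game_add_bottom nim_add_bottom)

lemma Field_tower: "Field (tower x) = Fresh ` {..<x}"
  by (force simp: tower_def Field_def)

lemma poset_game_tower: "poset_game (tower x)"
proof (rule poset_gameI)
  show "(v, v) \<in> tower x" if "v \<in> Field (tower x)" for v :: "'a vertex"
    using that unfolding Field_tower by (auto simp: tower_def)
qed (auto simp: Field_tower, auto simp: tower_def)

lemma move_tower: "j < x \<Longrightarrow> move (tower x) (Fresh j) = tower j"
  by (auto simp: move_def tower_def)

text \<open>Taking the vertex at height \<open>j\<close> leaves the \<open>j\<close> vertices below
  it, so a tower is a nim heap.\<close>

lemma nim_tower: "nim (tower x :: 'a vertex rel) = x"
proof (induction x rule: less_induct)
  case (less x)
  have "(\<lambda>v. nim (move (tower x) v)) ` Field (tower x :: 'a vertex rel) = {..<x}"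
    unfolding Field_tower image_image by (simp add: move_tower less)
  then show ?case
    unfolding nim_eq[OF poset_game_tower] by (auto intro: mex_eqI)
qed

lemma Field_beside: "Field (beside r s) = InL ` Field r \<union> InR ` Field s"
  unfolding beside_def Field_Un Field_map_prod ..

lemma poset_game_beside:
  assumes "poset_game r" "poset_game s"
  shows "poset_game (beside r s)"
proof (rule poset_gameI)
  show "finite (Field (beside r s))"
    using assms[THEN poset_gameD(1)] by (simp add: Field_beside)
  show "(v, v) \<in> beside r s" if "v \<in> Field (beside r s)" for v
    using that assms[THEN poset_gameD(2)] unfolding Field_beside
    by (auto simp: beside_def)
  show "(u, w) \<in> beside r s" if "(u, v) \<in> beside r s" "(v, w) \<in> beside r s" for u v w
    using that assms[THEN poset_gameD(3)] by (auto simp: beside_def)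
  show "u = v" if "(u, v) \<in> beside r s" "(v, u) \<in> beside r s" for u v
    using that assms[THEN poset_gameD(4)] by (auto simp: beside_def)
qed

lemma move_beside_InL: "move (beside r s) (InL v) = beside (move r v) s"
  by (auto simp: move_def beside_def intro!: map_prod_imageI)

lemma move_beside_InR: "move (beside r s) (InR v) = beside r (move s v)"
  by (auto simp: move_def beside_def intro!: map_prod_imageI)

lemma nim_beside: "poset_game r \<Longrightarrow> poset_game s \<Longrightarrow> nim (beside r s) = nim r XOR nim s"
proof (induction "card (Field r) + card (Field s)" arbitrary: r s rule: less_induct)
  case less
  note r = less.prems(1) and s = less.prems(2)
  let ?A = "(\<lambda>v. nim (move r v)) ` Field r" and ?B = "(\<lambda>v. nim (move s v)) ` Field s"
  have "nim (move (beside r s) (InL v)) = nim (move r v) XOR nim s" if "v \<in> Field r" for v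
    using less.hyps[OF _ poset_game_move[OF r] s] card_Field_move[OF r that]
    by (simp add: move_beside_InL)
  moreover have "nim (move (beside r s) (InR v)) = nim r XOR nim (move s v)" if "v \<in> Field s" for v
    using less.hyps[OF _ r poset_game_move[OF s]] card_Field_move[OF s that]
    by (simp add: move_beside_InR)
  ultimately have "(\<lambda>v. nim (move (beside r s) v)) ` Field (beside r s) =
      (\<lambda>x. x XOR nim s) ` ?A \<union> (\<lambda>y. nim r XOR y) ` ?B"
    unfolding Field_beside image_Un image_image by (simp)
  then show ?case
    unfolding nim_eq[OF poset_game_beside[OF r s]] nim_eq[OF r] nim_eq[OF s]
    using mex_xor[of ?A ?B] poset_gameD(1)[OF r] poset_gameD(1)[OF s] by simp
qed

section \<open>The effect of a stage on nim-values\<close>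

lemma poset_game_stage: "poset_game r \<Longrightarrow> poset_game (stage i r)"
  unfolding stage_def by (simp add: poset_game_beside poset_game_tower add_bottom_funpow)

lemma div_power2_Suc: "n div 2 ^ Suc i = n div 2 ^ i div 2" for n :: nat
  unfolding power_Suc2 by (rule div_mult2_eq)

text \<open>If bit \<open>i\<close> is clear, the addition sets it and the exclusive or clears it.
  If it is set, the addition clears it with a carry and the exclusive or restores it, so only the
  carry \<open>2 ^ Suc i\<close> remains.\<close>

lemma add_xor_power2:
  "(n + 2 ^ i) XOR 2 ^ i = (if odd (n div 2 ^ i) then n + 2 ^ Suc i else n)" for n :: nat
proof (induction i arbitrary: n)
  case 0
  show ?case
    by (subst xor_rec) (auto elim!: evenE oddE)
next
  case (Suc i)
  \<comment> \<open>The lowest bit is untouched and splits off, leaving exponent \<open>i\<close>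
    for \<open>n div 2\<close>.\<close>
  have "(n + 2 ^ Suc i) XOR 2 ^ Suc i = n mod 2 + 2 * ((n div 2 + 2 ^ i) XOR 2 ^ i)"
    by (subst xor_rec) (simp add: mod_2_eq_odd add.commute)
  then show ?case
    unfolding Suc by (simp add: div_mult2_eq)
qed

lemma nim_stage:
  assumes "poset_game r"
  shows "nim (stage i r) = (if odd (nim r div 2 ^ i) then nim r + 2 ^ Suc i else nim r)"
  unfolding stage_def
  using add_bottom_funpow[OF assms, of "2 ^ i"]
  by (simp add: nim_beside poset_game_tower nim_tower add_xor_power2)

text \<open>The bounds say that \<open>nim r div 2 ^ i\<close> is the ceiling of \<open>n / 2 ^ i\<close>.\<close>

definition stage_inv :: "nat \<Rightarrow> nat \<Rightarrow> 'a vertex rel \<Rightarrow> bool" where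
  "stage_inv n i r \<longleftrightarrow>
     poset_game r \<and> n \<le> 2 ^ i * (nim r div 2 ^ i) \<and> 2 ^ i * (nim r div 2 ^ i) < n + 2 ^ i"

text \<open>Rounding \<open>n / 2 ^ i\<close> up and then rounding half of the result up is the same
  as rounding \<open>n / 2 ^ Suc i\<close> up.\<close>

lemma stage_inv_stage:
  assumes "stage_inv n i r"
  shows "stage_inv n (Suc i) (stage i r)"
proof -
  define m where "m = nim r div 2 ^ i"
  have r: "poset_game r" and m: "n \<le> 2 ^ i * m" "2 ^ i * m < n + 2 ^ i"
    using assms by (auto simp: stage_inv_def m_def)
  have "nim (stage i r) div 2 ^ Suc i = (m + 1) div 2"
  proof -
    have "nim r div 2 ^ Suc i = m div 2"
      by (simp add: m_def div_power2_Suc del: power_Suc)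
    moreover have "(nim r + 2 ^ Suc i) div 2 ^ Suc i = nim r div 2 ^ Suc i + 1"
      by (rule div_add_self2) simp
    ultimately show ?thesis
      unfolding nim_stage[OF r] m_def[symmetric] by (auto elim!: evenE oddE)
  qed
  \<comment> \<open>At scale \<open>2 ^ i\<close> the rounding adds at most one unit, so both bounds
    become linear.\<close>
  moreover have eq: "2 ^ Suc i * ((m + 1) div 2) = 2 ^ i * (if odd m then m + 1 else m)"
    by (auto elim!: evenE oddE)
  have "n \<le> 2 ^ Suc i * ((m + 1) div 2)" "2 ^ Suc i * ((m + 1) div 2) < n + 2 ^ Suc i"
    unfolding eq using m by auto
  ultimately show ?thesis
    using poset_game_stage[OF r] by (simp add: stage_inv_def del: power_Suc)
qed

lemma run_stages_inv:
  assumes "poset_game G" "run_stages G = (i, r)"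
  shows "stage_inv (nim G) i r" "card (Field G) < 2 ^ i"
proof -
  have "case run_stages G of (i, r) \<Rightarrow> stage_inv (nim G) i r \<and> card (Field G) < 2 ^ i"
    unfolding run_stages_def
  proof (rule while_rule[where P = "\<lambda>(i, r). stage_inv (nim G) i r"
        and r = "measure (\<lambda>(i, r). Suc (card (Field G)) - i)"])
    show "case (0, embed G) of (i, r) \<Rightarrow> stage_inv (nim G) i r"
      using assms(1) by (simp add: stage_inv_def poset_game_embed nim_embed)
  next
    fix s :: "nat \<times> 'a vertex rel"
    assume "case s of (i, r) \<Rightarrow> 2 ^ i \<le> card (Field G)"
    \<comment> \<open>\<open>i < 2 ^ i\<close> bounds the counter while the guard holds, so the
      measure decreases.\<close>
    then have "fst s < Suc (card (Field G))"
      using less_le_trans[OF less_exp] by (fastforce split: prod.splits)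
    then show "((case s of (i, r) \<Rightarrow> (Suc i, stage i r)), s)
        \<in> measure (\<lambda>(i, r). Suc (card (Field G)) - i)"
      by (auto split: prod.splits)
  qed (auto intro: stage_inv_stage)
  with assms(2) show "stage_inv (nim G) i r" "card (Field G) < 2 ^ i"
    by auto
qed

theorem theorem1:
  fixes G :: "'a rel"
  assumes "poset_game G" and "nim G \<noteq> 0"
  shows "nim (neg_game G) = 0"
proof -
  obtain i r where run: "run_stages G = (i, r)"
    by fastforce
  define m where "m = nim r div 2 ^ i"
  have r: "poset_game r" and m: "nim G \<le> 2 ^ i * m" "2 ^ i * m < nim G + 2 ^ i"
    using run_stages_inv(1)[OF assms(1) run] by (auto simp: stage_inv_def m_def)
  have "nim G < 2 ^ i"
    using nim_le_card[OF assms(1)] run_stages_inv(2)[OF assms(1) run] by linarith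
  with m(2) have "2 ^ i * m < 2 ^ i * 2"
    by linarith
  \<comment> \<open>The ceiling of a positive quotient is positive: here
    \<open>nim G \<noteq> 0\<close> enters.\<close>
  moreover have "m \<noteq> 0"
    using m(1) assms(2) by (metis le_zero_eq mult_0_right)
  ultimately have "m = 1"
    by simp
  then have stage: "nim (stage i r) = nim r + 2 ^ Suc i"
    unfolding nim_stage[OF r] m_def by simp
  \<comment> \<open>Bit \<open>Suc i\<close> of \<open>nim r\<close> is clear, so
    \<open>add_xor_power2\<close> at exponent \<open>Suc i\<close> takes its even branch. The second
    game and the last tower together then have value \<open>nim r\<close>, which cancels the first
    game.\<close>
  have "nim r div 2 ^ Suc i = 0"
    using \<open>m = 1\<close> by (simp add: m_def div_power2_Suc del: power_Suc)
  then have "(nim r + 2 ^ Suc i) XOR 2 ^ Suc i = nim r"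
    unfolding add_xor_power2 by simp
  then show ?thesis
    unfolding neg_game_def run
    using r poset_game_stage[OF r, of i]
    by (simp add: nim_beside poset_game_beside poset_game_tower nim_tower stage xor.assoc
        del: power_Suc)
qed

end
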